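(* Let $\Omega$ be a finite set and let $G\leq\mathrm{Sym}(\Omega)$ be transitive. Let $\Sigma=\{\Delta_1,\ldots,\Delta_\ell\}$ be a block system for $G$ in $\Omega$, set $\Delta=\Delta_1$ and let $\alpha\in\Delta_1$. Let $G_1=G^{\Sigma}\leq\mathrm{Sym}(\Sigma)$, $G_0=G_\Delta^\Delta\leq\mathrm{Sym}(\Delta)$, $A=G_\alpha$, $A_0=A^\Delta$, $A_1=(G_1)_{\Delta_1}$ and $\hat A=(A_0\times G_0^{\ell-1})\rtimes A_1\leq G_0\wr G_1$. Suppose also that $B\leq G$, and let $B_1=B^\Sigma$ and $B_0=B_\Delta^\Delta$. Then there is a permutation embedding $(\varphi,\psi)$ of $(G,\Omega)$ into $(G_0\wr G_1,\Delta\times\Sigma)$ such that $\varphi(A)=\hat A\cap\varphi(G)$, and if $B_1$ is transitive (on $\Sigma$) then $\varphi$ may be chosen such that also $\varphi(B)\leq B_0\wr B_1$.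
   Context: For a group $X\le G$, $X^\Sigma$ is the permutation group induced by $X$ on $\Sigma$, $X_\Delta$ is the setwise stabiliser of $\Delta$ in $X$, and $X_\Delta^\Delta$ is the permutation group it induces on $\Delta$; $A^\Delta$ is the group induced by $A\le G_\Delta$ on $\Delta$. The wreath product $G_0\wr G_1$ is $\mathrm{Fun}(\Sigma,G_0)\rtimes G_1$, where $\mathrm{Fun}(\Sigma,G_0)\cong G_0^\ell$ is the group of all functions $\Sigma\to G_0$ under pointwise multiplication, acting on $\Delta\times\Sigma$ by $(\delta,\Delta_i)^{f}=(\delta^{f(\Delta_i)},\Delta_i)$ and $(\delta,\Delta_i)^\sigma=(\delta,\Delta_i^\sigma)$ for $f\in\mathrm{Fun}(\Sigma,G_0)$, $\sigma\in G_1$ (right actions; $f\sigma$ means first $f$ then $\sigma$). Here $\hat A=\{f\sigma: f(\Delta_1)\in A_0,\ \sigma\in A_1\}$ and $B_0\wr B_1=\{f\sigma : f(\Delta_i)\in B_0\text{ for all } i,\ \sigma\in B_1\}$. A permutation embedding of $(G,\Omega)$ into $(G_0\wr G_1,\Delta\times\Sigma)$ is a pair $(\varphi,\psi)$ with $\varphi:G\to G_0\wr G_1$ a monomorphism and $\psi:\Omega\to\Delta\times\Sigma$ a bijection such that $(\psi(\delta))^{\varphi(g)}=\psi(\delta^g)$ for all $\delta\in\Omega$, $g\in G$. *)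

theory Defs
  imports "HOL-Algebra.Bij" "HOL-Library.Disjoint_Sets"
begin

text \<open>
  Permutations act on the right: the image \<open>x\<^sup>g\<close> is the application \<open>g x\<close>, and the product of
  \<open>g\<close> and \<open>h\<close> is ``first \<open>g\<close>, then \<open>h\<close>''. \<^const>\<open>BijGroup\<close> multiplies in the opposite order, so
  its multiplication is reversed here. As in \<^const>\<open>BijGroup\<close>, permutations of \<open>\<Omega>\<close> are
  extensional functions, i.e. they are \<^const>\<open>undefined\<close> outside \<open>\<Omega>\<close>.
\<close>

definition Sym :: "'a set \<Rightarrow> ('a \<Rightarrow> 'a) monoid" where
  "Sym \<Omega> = (BijGroup \<Omega>)\<lparr>mult := \<lambda>g h. h \<otimes>\<^bsub>BijGroup \<Omega>\<^esub> g\<rparr>"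

definition perm_group :: "'a set \<Rightarrow> ('a \<Rightarrow> 'a) set \<Rightarrow> ('a \<Rightarrow> 'a) monoid" where
  "perm_group \<Omega> X = (Sym \<Omega>)\<lparr>carrier := X\<rparr>"

definition transitive_on :: "('a \<Rightarrow> 'a) set \<Rightarrow> 'a set \<Rightarrow> bool" where
  "transitive_on X \<Omega> \<longleftrightarrow> (\<forall>x\<in>\<Omega>. \<forall>y\<in>\<Omega>. \<exists>g\<in>X. g x = y)"

definition block_system :: "('a \<Rightarrow> 'a) set \<Rightarrow> 'a set \<Rightarrow> 'a set set \<Rightarrow> bool" where
  "block_system X \<Omega> S \<longleftrightarrow> partition_on \<Omega> S \<and> (\<forall>g\<in>X. \<forall>D\<in>S. g ` D \<in> S)"

definition point_stabiliser :: "('a \<Rightarrow> 'a) set \<Rightarrow> 'a \<Rightarrow> ('a \<Rightarrow> 'a) set" where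
  "point_stabiliser X x = {g \<in> X. g x = x}"

definition setwise_stabiliser :: "('a \<Rightarrow> 'a) set \<Rightarrow> 'a set \<Rightarrow> ('a \<Rightarrow> 'a) set" where
  "setwise_stabiliser X D = {g \<in> X. g ` D = D}"

text \<open>
  \<open>induced_on_set X D\<close> is \<open>X\<^sup>D\<close> for a group \<open>X\<close> that stabilises \<open>D\<close> setwise, and
  \<open>induced_on_blocks X S\<close> is \<open>X\<^sup>S\<close> for a group \<open>X\<close> that permutes the members of \<open>S\<close>.
\<close>

definition induced_on_set :: "('a \<Rightarrow> 'a) set \<Rightarrow> 'a set \<Rightarrow> ('a \<Rightarrow> 'a) set" where
  "induced_on_set X D = (\<lambda>g. \<lambda>x\<in>D. g x) ` X"

definition induced_on_blocks :: "('a \<Rightarrow> 'a) set \<Rightarrow> 'a set set \<Rightarrow> ('a set \<Rightarrow> 'a set) set" where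
  "induced_on_blocks X S = (\<lambda>g. \<lambda>D\<in>S. g ` D) ` X"

text \<open>
  The wreath product \<open>K \<wr> P = Fun(S, K) \<rtimes> P\<close> of a group \<open>K\<close> and a group \<open>P\<close> of permutations of \<open>S\<close>.
  The pair \<open>(f, \<sigma>)\<close> stands for the product \<open>f\<sigma>\<close>, and \<open>(f\<sigma>)(g\<tau>) = (f \<cdot> \<sigma>g\<sigma>\<^sup>-\<^sup>1)(\<sigma>\<tau>)\<close>, where
  the conjugate \<open>\<sigma>g\<sigma>\<^sup>-\<^sup>1\<close> is the function sending \<open>i\<close> to \<open>g(i\<^sup>\<sigma>)\<close>.
\<close>

definition wreath ::
  "('k, 'm) monoid_scheme \<Rightarrow> 's set \<Rightarrow> ('s \<Rightarrow> 's) set \<Rightarrow> (('s \<Rightarrow> 'k) \<times> ('s \<Rightarrow> 's)) monoid" where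
  "wreath K S P =
    \<lparr>carrier = (S \<rightarrow>\<^sub>E carrier K) \<times> P,
     mult = \<lambda>(f, \<sigma>) (g, \<tau>). (\<lambda>i\<in>S. f i \<otimes>\<^bsub>K\<^esub> g (\<sigma> i), \<sigma> \<otimes>\<^bsub>Sym S\<^esub> \<tau>),
     one = (\<lambda>i\<in>S. \<one>\<^bsub>K\<^esub>, \<one>\<^bsub>Sym S\<^esub>)\<rparr>"

text \<open>The imprimitive action: first \<open>(d, i) \<mapsto> (d\<^sup>f\<^sup>(\<^sup>i\<^sup>), i)\<close>, then \<open>(d, i) \<mapsto> (d, i\<^sup>\<sigma>)\<close>.\<close>

definition wreath_act ::
  "('s \<Rightarrow> ('d \<Rightarrow> 'd)) \<times> ('s \<Rightarrow> 's) \<Rightarrow> 'd \<times> 's \<Rightarrow> 'd \<times> 's" where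
  "wreath_act = (\<lambda>(f, \<sigma>) (d, i). (f i d, \<sigma> i))"

definition perm_embedding ::
  "('a \<Rightarrow> 'a) set \<Rightarrow> 'a set \<Rightarrow> ('d \<Rightarrow> 'd) set \<Rightarrow> ('s \<Rightarrow> 's) set \<Rightarrow> 'd set \<Rightarrow> 's set \<Rightarrow>
    (('a \<Rightarrow> 'a) \<Rightarrow> ('s \<Rightarrow> ('d \<Rightarrow> 'd)) \<times> ('s \<Rightarrow> 's)) \<Rightarrow> ('a \<Rightarrow> 'd \<times> 's) \<Rightarrow> bool" where
  "perm_embedding G \<Omega> G0 G1 D S \<phi> \<psi> \<longleftrightarrow>
    \<phi> \<in> mon (perm_group \<Omega> G) (wreath (perm_group D G0) S G1) \<and>
    bij_betw \<psi> \<Omega> (D \<times> S) \<and>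
    (\<forall>x\<in>\<Omega>. \<forall>g\<in>G. wreath_act (\<phi> g) (\<psi> x) = \<psi> (g x))"

end

theory Submission
  imports Defs
begin

text \<open>
  By transitivity each block \<open>D\<close> is the image of the distinguished block \<open>\<Delta>\<close> under some group
  element \<open>t\<^sub>D\<close>, and this element identifies \<open>D\<close> with \<open>\<Delta>\<close>. A point \<open>x\<close> is then determined by
  its block \<open>D\<close> and by the point of \<open>\<Delta>\<close> that \<open>t\<^sub>D\<close> carries to it: this is the bijection
  \<open>\<psi>\<close> onto \<open>\<Delta> \<times> \<Sigma>\<close>. Written in these coordinates, \<open>g\<close> permutes the blocks and moves the
  fibre over \<open>D\<close> to the fibre over \<open>D\<^sup>g\<close> by \<open>t\<^sub>D g t\<^sup>-\<^sup>1\<close> with \<open>t = t\<^bsub>D\<^sup>g\<^esub>\<close>. That product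
  stabilises \<open>\<Delta>\<close>, so it induces an element of \<open>G\<^sub>0\<close>, and together the fibre maps and the
  permutation of the blocks form \<open>\<phi>(g)\<close>, an element of the wreath product. Multiplicativity is the
  telescoping of consecutive fibre maps, and \<open>\<phi>\<close> is injective since the action on \<open>\<Omega>\<close> can be
  read off through \<open>\<psi>\<close>.

  Two choices of the transversal give the two additional claims. If \<open>t\<^sub>\<Delta>\<close> is the identity, then
  for \<open>g\<close> stabilising \<open>\<Delta>\<close> the fibre map over \<open>\<Delta>\<close> is the restriction of \<open>g\<close> itself, so that
  membership of \<open>\<phi>(g)\<close> in the group of pairs fixing \<open>(\<alpha>, \<Delta>)\<close> tests whether \<open>g\<close> fixes \<open>\<alpha>\<close>
  (\<open>embed_point_stabiliser\<close>). If all \<open>t\<^sub>D\<close> lie in a subgroup \<open>H\<close>, which is possible when \<open>H\<close> is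
  transitive on the blocks, then for \<open>g \<in> H\<close> the products above lie in the stabiliser of \<open>\<Delta>\<close>
  in \<open>H\<close>, so \<open>\<phi>(H)\<close> lies in the wreath product formed from \<open>H\<close> alone
  (\<open>embed_image_subgroup\<close>). As \<open>\<phi>\<close> depends only on \<open>t\<close>, the same
  construction serves \<open>G\<close> and \<open>H\<close> at once.
\<close>

section \<open>Groups of permutations under right action\<close>

lemma Sym_simps [simp]:
  "carrier (Sym S) = Bij S"
  "\<one>\<^bsub>Sym S\<^esub> = (\<lambda>x\<in>S. x)"
  "g \<in> Bij S \<Longrightarrow> h \<in> Bij S \<Longrightarrow> g \<otimes>\<^bsub>Sym S\<^esub> h = compose S h g"
  by (simp_all add: Sym_def BijGroup_def)

lemma perm_group_simps [simp]:
  "carrier (perm_group S X) = X"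
  "\<one>\<^bsub>perm_group S X\<^esub> = (\<lambda>x\<in>S. x)"
  "(\<otimes>\<^bsub>perm_group S X\<^esub>) = (\<otimes>\<^bsub>Sym S\<^esub>)"
  using Sym_simps(2)[of S] by (simp_all add: perm_group_def)

lemma Bij_D:
  assumes "g \<in> Bij S"
  shows "g \<in> extensional S" "bij_betw g S S" "inj_on g S" "g ` S = S"
    "\<And>x. x \<in> S \<Longrightarrow> g x \<in> S"
  using assms by (auto simp: Bij_def bij_betw_def)

lemma group_Sym: "group (Sym S)"
proof (rule groupI)
  fix g assume g: "g \<in> carrier (Sym S)"
  let ?h = "\<lambda>x\<in>S. inv_into S g x"
  have h: "?h \<in> Bij S" using g by (simp add: restrict_inv_into_Bij)
  moreover have "compose S g ?h = (\<lambda>x\<in>S. x)"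
    using g by (auto simp: Bij_def bij_betw_def intro!: ext simp: compose_def f_inv_into_f)
  ultimately show "\<exists>h\<in>carrier (Sym S). h \<otimes>\<^bsub>Sym S\<^esub> g = \<one>\<^bsub>Sym S\<^esub>"
    using g by (intro bexI[of _ ?h]) auto
next
  fix g h k assume "g \<in> carrier (Sym S)" "h \<in> carrier (Sym S)" "k \<in> carrier (Sym S)"
  then show "g \<otimes>\<^bsub>Sym S\<^esub> h \<otimes>\<^bsub>Sym S\<^esub> k = g \<otimes>\<^bsub>Sym S\<^esub> (h \<otimes>\<^bsub>Sym S\<^esub> k)"
    by (simp add: compose_Bij compose_assoc[OF Bij_imp_funcset])
qed (auto simp: compose_Bij id_Bij compose_Id[OF Bij_imp_funcset Bij_imp_extensional])

lemma inv_Sym: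
  assumes "g \<in> Bij S"
  shows "inv\<^bsub>Sym S\<^esub> g = (\<lambda>x\<in>S. inv_into S g x)"
proof (rule group.inv_equality[OF group_Sym])
  show "(\<lambda>x\<in>S. inv_into S g x) \<otimes>\<^bsub>Sym S\<^esub> g = \<one>\<^bsub>Sym S\<^esub>"
    using assms Bij_D[OF assms] restrict_inv_into_Bij[OF assms]
    by (auto simp: compose_def f_inv_into_f intro!: ext)
qed (use assms in \<open>auto simp: restrict_inv_into_Bij\<close>)

lemma subgroup_Sym_D:
  assumes "subgroup X (Sym S)"
  shows "X \<subseteq> Bij S" "(\<lambda>x\<in>S. x) \<in> X"
    "\<And>g h. g \<in> X \<Longrightarrow> h \<in> X \<Longrightarrow> compose S h g \<in> X"
    "\<And>g. g \<in> X \<Longrightarrow> (\<lambda>x\<in>S. inv_into S g x) \<in> X"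
proof -
  show *: "X \<subseteq> Bij S" using subgroup.subset[OF assms] by simp
  show "(\<lambda>x\<in>S. x) \<in> X" using subgroup.one_closed[OF assms] by simp
  show "compose S h g \<in> X" if "g \<in> X" "h \<in> X" for g h
    using subgroup.m_closed[OF assms that] that * by (simp add: subsetD)
  show "(\<lambda>x\<in>S. inv_into S g x) \<in> X" if "g \<in> X" for g
    using subgroup.m_inv_closed[OF assms that] inv_Sym[of g S] * that by auto
qed

lemma group_perm_group:
  assumes "subgroup X (Sym S)"
  shows "group (perm_group S X)"
  unfolding perm_group_def by (rule subgroup.subgroup_is_group[OF assms group_Sym])

lemma subgroup_Sym_if_subgroup_perm_group:
  assumes "subgroup X (Sym S)" "subgroup Y (perm_group S X)"
  shows "subgroup Y (Sym S)"
  using group.incl_subgroup[OF group_Sym assms(1)] assms(2) by (simp add: perm_group_def)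

lemma subgroup_setwise_stabiliser:
  assumes X: "subgroup X (Sym \<Omega>)" and D: "D \<subseteq> \<Omega>"
  shows "subgroup (setwise_stabiliser X D) (Sym \<Omega>)"
proof (rule group.subgroupI[OF group_Sym])
  note X' = subgroup_Sym_D[OF X]
  show "setwise_stabiliser X D \<subseteq> carrier (Sym \<Omega>)"
    using X'(1) by (auto simp: setwise_stabiliser_def)
  have "(\<lambda>x\<in>\<Omega>. x) ` D = D" using D by (force simp: image_def)
  then have "(\<lambda>x\<in>\<Omega>. x) \<in> setwise_stabiliser X D"
    using X'(2) by (simp only: setwise_stabiliser_def mem_Collect_eq simp_thms)
  then show "setwise_stabiliser X D \<noteq> {}" by blast
next
  note X' = subgroup_Sym_D[OF X]
  fix g assume g: "g \<in> setwise_stabiliser X D"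
  then have gB: "g \<in> Bij \<Omega>" "g \<in> X" "g ` D = D" using X' by (auto simp: setwise_stabiliser_def)
  have "(\<lambda>x\<in>\<Omega>. inv_into \<Omega> g x) ` (g ` D) = D"
    using D gB(1) by (force simp: image_image Bij_D inv_into_f_f subset_iff)
  then show "inv\<^bsub>Sym \<Omega>\<^esub> g \<in> setwise_stabiliser X D"
    using gB X' by (simp add: inv_Sym setwise_stabiliser_def)
  fix h assume h: "h \<in> setwise_stabiliser X D"
  then have hB: "h \<in> Bij \<Omega>" "h \<in> X" "h ` D = D" using X' by (auto simp: setwise_stabiliser_def)
  have "compose \<Omega> h g ` D = h ` g ` D" using D by (force simp: compose_def image_image)
  then show "g \<otimes>\<^bsub>Sym \<Omega>\<^esub> h \<in> setwise_stabiliser X D"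
    using gB hB X' by (simp add: setwise_stabiliser_def)
qed

text \<open>Restriction to an invariant set is a homomorphism, with the induced group as its image.\<close>

lemma subgroup_induced_on_set:
  assumes X: "subgroup X (Sym \<Omega>)" and D: "D \<subseteq> \<Omega>" and stab: "\<And>g. g \<in> X \<Longrightarrow> g ` D = D"
  shows "subgroup (induced_on_set X D) (Sym D)"
proof -
  note X' = subgroup_Sym_D[OF X]
  have Bij: "(\<lambda>x\<in>D. g x) \<in> Bij D" if "g \<in> X" for g
    using stab[OF that] inj_on_subset[OF Bij_D(3)[OF subsetD[OF X'(1) that]] D]
    by (simp add: Bij_def bij_betw_def)
  have "group_hom (perm_group \<Omega> X) (Sym D) (\<lambda>g. \<lambda>x\<in>D. g x)"
  proof (intro group_hom.intro group_hom_axioms.intro group_perm_group[OF X] group_Sym homI)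
    fix g h assume g: "g \<in> carrier (perm_group \<Omega> X)" and h: "h \<in> carrier (perm_group \<Omega> X)"
    then have "g \<in> Bij \<Omega>" "h \<in> Bij \<Omega>" using X'(1) by auto
    moreover have "g x \<in> D" if "x \<in> D" for x using stab[of g] g that by auto
    ultimately show "(\<lambda>x\<in>D. (g \<otimes>\<^bsub>perm_group \<Omega> X\<^esub> h) x) =
        (\<lambda>x\<in>D. g x) \<otimes>\<^bsub>Sym D\<^esub> (\<lambda>x\<in>D. h x)"
      using D g h Bij[of g] Bij[of h] by (auto simp: compose_def intro!: ext)
  qed (use Bij in auto)
  from group_hom.img_is_subgroup[OF this] show ?thesis by (simp add: induced_on_set_def)
qed

lemma subgroup_induced_on_blocks:
  assumes X: "subgroup X (Sym \<Omega>)" and S: "block_system X \<Omega> S"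
  shows "subgroup (induced_on_blocks X S) (Sym S)"
proof -
  note X' = subgroup_Sym_D[OF X]
  have sub: "D \<subseteq> \<Omega>" if "D \<in> S" for D
    using S that by (auto simp: block_system_def partition_on_def)
  have im: "g ` D \<in> S" if "g \<in> X" "D \<in> S" for g D
    using S that by (auto simp: block_system_def)
  have Bij: "(\<lambda>D\<in>S. g ` D) \<in> Bij S" if g: "g \<in> X" for g
  proof -
    have gB: "g \<in> Bij \<Omega>" using X' g by auto
    have "inj_on (\<lambda>D. g ` D) S"
      using inj_on_image_eq_iff[OF Bij_D(3)[OF gB]] sub by (auto simp: inj_on_def)
    moreover have "D \<in> (\<lambda>D. g ` D) ` S" if "D \<in> S" for D
    proof
      let ?h = "\<lambda>x\<in>\<Omega>. inv_into \<Omega> g x"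
      show "?h ` D \<in> S" using im X'(4) g that by blast
      have "g (?h x) = x" if "x \<in> D" for x
        using that \<open>D \<in> S\<close> sub Bij_D(4)[OF gB] by (auto simp: f_inv_into_f)
      then have "g ` ?h ` D = (\<lambda>x. x) ` D" unfolding image_image by (rule image_cong[OF refl])
      then show "D = g ` ?h ` D" by simp
    qed
    ultimately show ?thesis using im[OF g] by (auto simp: Bij_def bij_betw_def)
  qed
  have "group_hom (perm_group \<Omega> X) (Sym S) (\<lambda>g. \<lambda>D\<in>S. g ` D)"
  proof (intro group_hom.intro group_hom_axioms.intro group_perm_group[OF X] group_Sym homI)
    fix g h assume g: "g \<in> carrier (perm_group \<Omega> X)" and h: "h \<in> carrier (perm_group \<Omega> X)"
    then have B: "g \<in> Bij \<Omega>" "h \<in> Bij \<Omega>" using X'(1) by auto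
    have "compose \<Omega> h g ` D = h ` g ` D" if "D \<in> S" for D
      using sub[OF that] by (force simp: compose_def)
    then show "(\<lambda>D\<in>S. (g \<otimes>\<^bsub>perm_group \<Omega> X\<^esub> h) ` D) =
        (\<lambda>D\<in>S. g ` D) \<otimes>\<^bsub>Sym S\<^esub> (\<lambda>D\<in>S. h ` D)"
      using B g h im Bij[of g] Bij[of h] by (auto simp: compose_def intro!: ext)
  qed (use Bij in auto)
  from group_hom.img_is_subgroup[OF this] show ?thesis by (simp add: induced_on_blocks_def)
qed


section \<open>The wreath product is a group\<close>

lemma group_wreath:
  assumes K: "group K" and P: "subgroup P (Sym S)"
  shows "group (wreath K S P)"
proof -
  interpret K: group K by fact
  note P' = subgroup_Sym_D[OF P]
  have app: "\<sigma> i \<in> S" if "\<sigma> \<in> P" "i \<in> S" for \<sigma> i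
    using Bij_D(5)[OF subsetD[OF P'(1) that(1)] that(2)] .
  have mult: "\<sigma> \<otimes>\<^bsub>Sym S\<^esub> \<tau> = compose S \<tau> \<sigma>" if "\<sigma> \<in> P" "\<tau> \<in> P" for \<sigma> \<tau>
    using that P'(1) by (simp add: subsetD)
  show ?thesis
  proof (rule groupI)
    fix x assume x: "x \<in> carrier (wreath K S P)"
    then obtain f \<sigma> where x_eq: "x = (f, \<sigma>)" and f: "f \<in> S \<rightarrow>\<^sub>E carrier K" and s: "\<sigma> \<in> P"
      by (auto simp: wreath_def)
    let ?t = "\<lambda>i\<in>S. inv_into S \<sigma> i"
    have t: "?t \<in> P" using P'(4)[OF s] .
    have "\<sigma> (?t i) = i" if "i \<in> S" for i
      using that s P'(1) Bij_D(4)[of \<sigma> S] by (auto simp: f_inv_into_f)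
    \<comment> \<open>The inverse of \<open>f\<sigma>\<close> is \<open>\<sigma>\<^sup>-\<^sup>1f\<^sup>-\<^sup>1 = (\<sigma>\<^sup>-\<^sup>1f\<^sup>-\<^sup>1\<sigma>)\<sigma>\<^sup>-\<^sup>1\<close>.\<close>
    then show "\<exists>y\<in>carrier (wreath K S P). y \<otimes>\<^bsub>wreath K S P\<^esub> x = \<one>\<^bsub>wreath K S P\<^esub>"
      using f s t app[OF t] mult[OF t s]
      by (intro bexI[of _ "(\<lambda>i\<in>S. inv\<^bsub>K\<^esub> f (?t i), ?t)"])
        (auto simp: wreath_def x_eq compose_def PiE_iff intro!: ext)
  next
    fix x y z assume "x \<in> carrier (wreath K S P)" "y \<in> carrier (wreath K S P)"
      "z \<in> carrier (wreath K S P)"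
    then show "x \<otimes>\<^bsub>wreath K S P\<^esub> y \<otimes>\<^bsub>wreath K S P\<^esub> z =
        x \<otimes>\<^bsub>wreath K S P\<^esub> (y \<otimes>\<^bsub>wreath K S P\<^esub> z)"
      using app P'(3)
      by (auto simp: wreath_def mult PiE_iff K.m_assoc compose_def intro!: ext)
  next
    fix x assume "x \<in> carrier (wreath K S P)"
    then show "\<one>\<^bsub>wreath K S P\<^esub> \<otimes>\<^bsub>wreath K S P\<^esub> x = x"
      using P'(2) P'(1)
      by (auto simp: wreath_def mult PiE_iff compose_def extensional_def Bij_def intro!: ext)
  qed (use app P'(2,3) in \<open>auto simp: wreath_def mult PiE_iff\<close>)
qed


section \<open>The embedding given by a transversal\<close>

definition block_of :: "'a set set \<Rightarrow> 'a \<Rightarrow> 'a set" where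
  "block_of \<Sigma> x = (THE D. D \<in> \<Sigma> \<and> x \<in> D)"

definition transversal_coords ::
  "'a set \<Rightarrow> 'a set set \<Rightarrow> ('a set \<Rightarrow> 'a \<Rightarrow> 'a) \<Rightarrow> 'a \<Rightarrow> 'a \<times> 'a set" where
  "transversal_coords \<Omega> \<Sigma> t x = (inv_into \<Omega> (t (block_of \<Sigma> x)) x, block_of \<Sigma> x)"

definition wreath_embed ::
  "'a set \<Rightarrow> 'a set set \<Rightarrow> 'a set \<Rightarrow> ('a set \<Rightarrow> 'a \<Rightarrow> 'a) \<Rightarrow> ('a \<Rightarrow> 'a)
    \<Rightarrow> ('a set \<Rightarrow> 'a \<Rightarrow> 'a) \<times> ('a set \<Rightarrow> 'a set)" where
  "wreath_embed \<Omega> \<Sigma> \<Delta> t g =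
    (\<lambda>D\<in>\<Sigma>. \<lambda>d\<in>\<Delta>. inv_into \<Omega> (t (g ` D)) (g (t D d)), \<lambda>D\<in>\<Sigma>. g ` D)"

text \<open>
  The group \<open>X\<close> containing the transversal is a parameter, but \<open>wreath_embed\<close> and
  \<open>transversal_coords\<close> above are independent of it. Thus a transversal taken from a subgroup gives an
  interpretation for the subgroup and one for the whole group, both about the same two maps.
\<close>

locale block_transversal =
  fixes \<Omega> :: "'a set" and X :: "('a \<Rightarrow> 'a) set" and \<Sigma> :: "'a set set" and \<Delta> :: "'a set"
    and t :: "'a set \<Rightarrow> 'a \<Rightarrow> 'a"
  assumes subgroup_X: "subgroup X (Sym \<Omega>)"
    and blocks: "block_system X \<Omega> \<Sigma>"
    and \<Delta>: "\<Delta> \<in> \<Sigma>"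
    and t_X: "D \<in> \<Sigma> \<Longrightarrow> t D \<in> X"
    and t_image: "D \<in> \<Sigma> \<Longrightarrow> t D ` \<Delta> = D"
begin

abbreviation "X0 \<equiv> induced_on_set (setwise_stabiliser X \<Delta>) \<Delta>"
abbreviation "X1 \<equiv> induced_on_blocks X \<Sigma>"
abbreviation "\<phi> \<equiv> wreath_embed \<Omega> \<Sigma> \<Delta> t"
abbreviation "\<psi> \<equiv> transversal_coords \<Omega> \<Sigma> t"

lemmas X_D = subgroup_Sym_D[OF subgroup_X]

lemma partition: "partition_on \<Omega> \<Sigma>"
  using blocks by (simp add: block_system_def)

lemma block_subset: "D \<in> \<Sigma> \<Longrightarrow> D \<subseteq> \<Omega>"
  using partition by (auto simp: partition_on_def)

lemma block_image: "g \<in> X \<Longrightarrow> D \<in> \<Sigma> \<Longrightarrow> g ` D \<in> \<Sigma>"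
  using blocks by (simp add: block_system_def)

lemma X_Bij: "g \<in> X \<Longrightarrow> g \<in> Bij \<Omega>"
  using X_D(1) by auto

lemma block_of_eq: "D \<in> \<Sigma> \<Longrightarrow> x \<in> D \<Longrightarrow> block_of \<Sigma> x = D"
  using partition unfolding block_of_def partition_on_def disjoint_def
  by (intro the_equality) blast+

lemma block_ofE:
  assumes "x \<in> \<Omega>"
  obtains D where "D \<in> \<Sigma>" "x \<in> D" "block_of \<Sigma> x = D"
  using assms partition block_of_eq by (auto simp: partition_on_def)

lemma t_in_block: "D \<in> \<Sigma> \<Longrightarrow> d \<in> \<Delta> \<Longrightarrow> t D d \<in> D"
  using t_image by blast

lemma t_inv:
  assumes "D \<in> \<Sigma>" "x \<in> D"
  shows "inv_into \<Omega> (t D) x \<in> \<Delta>" "t D (inv_into \<Omega> (t D) x) = x"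
proof -
  from assms obtain d where d: "d \<in> \<Delta>" "x = t D d" using t_image by blast
  have "inv_into \<Omega> (t D) x = d"
    using d block_subset[OF \<Delta>] inv_into_f_f[OF Bij_D(3)[OF X_Bij[OF t_X[OF assms(1)]]]] by auto
  with d show "inv_into \<Omega> (t D) x \<in> \<Delta>" "t D (inv_into \<Omega> (t D) x) = x" by auto
qed

lemma inv_t: "D \<in> \<Sigma> \<Longrightarrow> d \<in> \<Delta> \<Longrightarrow> inv_into \<Omega> (t D) (t D d) = d"
  using inv_into_f_f[OF Bij_D(3)[OF X_Bij[OF t_X]]] block_subset[OF \<Delta>] by auto

lemma subgroup_X0: "subgroup X0 (Sym \<Delta>)"
  by (rule subgroup_induced_on_set
      [OF subgroup_setwise_stabiliser[OF subgroup_X block_subset[OF \<Delta>]] block_subset[OF \<Delta>]])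
    (simp add: setwise_stabiliser_def)

lemma subgroup_X1: "subgroup X1 (Sym \<Sigma>)"
  by (rule subgroup_induced_on_blocks[OF subgroup_X blocks])

lemma group_wreath_X: "group (wreath (perm_group \<Delta> X0) \<Sigma> X1)"
  by (intro group_wreath group_perm_group subgroup_X0 subgroup_X1)

text \<open>
  The fibre map over \<open>D\<close> is induced by the product of \<open>t\<^sub>D\<close>, \<open>g\<close> and the inverse of the
  transversal element of \<open>D\<^sup>g\<close>. All three factors lie in \<open>X\<close>, and they carry \<open>\<Delta>\<close> to \<open>D\<close>,
  to \<open>D\<^sup>g\<close> and back to \<open>\<Delta>\<close>.
\<close>

lemma component_in_X0:
  assumes g: "g \<in> X" and D: "D \<in> \<Sigma>"
  shows "(\<lambda>d\<in>\<Delta>. inv_into \<Omega> (t (g ` D)) (g (t D d))) \<in> X0"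
proof -
  note gD = block_image[OF g D]
  define h where "h = compose \<Omega> (\<lambda>x\<in>\<Omega>. inv_into \<Omega> (t (g ` D)) x) (compose \<Omega> g (t D))"
  have hX: "h \<in> X" unfolding h_def using X_D(3,4) g t_X[OF D] t_X[OF gD] by blast
  have h_eq: "h d = inv_into \<Omega> (t (g ` D)) (g (t D d))" if "d \<in> \<Delta>" for d
  proof -
    have "d \<in> \<Omega>" "t D d \<in> \<Omega>" "g (t D d) \<in> \<Omega>"
      using that block_subset D \<Delta> t_in_block[OF D that] Bij_D(5)[OF X_Bij[OF g]] by auto
    then show ?thesis by (simp add: h_def compose_def)
  qed
  have "h ` \<Delta> = \<Delta>"
  proof
    show "h ` \<Delta> \<subseteq> \<Delta>" using h_eq t_inv(1)[OF gD] t_in_block[OF D] by auto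
    show "\<Delta> \<subseteq> h ` \<Delta>"
    proof
      fix d assume d: "d \<in> \<Delta>"
      from t_in_block[OF gD d] obtain x where x: "x \<in> D" "t (g ` D) d = g x" by blast
      then have "h (inv_into \<Omega> (t D) x) = d"
        using h_eq[OF t_inv(1)[OF D x(1)]] t_inv(2)[OF D x(1)] inv_t[OF gD d] by simp
      then show "d \<in> h ` \<Delta>" using t_inv(1)[OF D x(1)] by blast
    qed
  qed
  moreover have "(\<lambda>d\<in>\<Delta>. inv_into \<Omega> (t (g ` D)) (g (t D d))) = (\<lambda>d\<in>\<Delta>. h d)"
    using h_eq by (auto intro: restrict_ext)
  ultimately show ?thesis
    using hX by (auto simp: induced_on_set_def setwise_stabiliser_def)
qed

text \<open>
  In the product of the fibre maps of \<open>g\<close> over \<open>D\<close> and of \<open>h\<close> over \<open>D\<^sup>g\<close> the inverse of the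
  transversal element of \<open>D\<^sup>g\<close> meets that element, which leaves the fibre map of \<open>gh\<close> over
  \<open>D\<close>; the shift from \<open>D\<close> to \<open>D\<^sup>g\<close> is the one in the multiplication of the wreath product.
\<close>

lemma embed_hom: "\<phi> \<in> hom (perm_group \<Omega> X) (wreath (perm_group \<Delta> X0) \<Sigma> X1)"
proof (rule homI)
  show "\<phi> g \<in> carrier (wreath (perm_group \<Delta> X0) \<Sigma> X1)" if "g \<in> carrier (perm_group \<Omega> X)" for g
    using that component_in_X0
    by (auto simp: wreath_def wreath_embed_def induced_on_blocks_def)
next
  fix g h assume "g \<in> carrier (perm_group \<Omega> X)" "h \<in> carrier (perm_group \<Omega> X)"
  then have g: "g \<in> X" and h: "h \<in> X" by simp_all
  have gh: "g \<otimes>\<^bsub>perm_group \<Omega> X\<^esub> h = compose \<Omega> h g" using g h X_Bij by simp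
  have im: "compose \<Omega> h g ` D = h ` g ` D" if "D \<in> \<Sigma>" for D
    using block_subset[OF that] by (force simp: compose_def)
  have blocks_Bij: "(\<lambda>D\<in>\<Sigma>. k ` D) \<in> Bij \<Sigma>" if "k \<in> X" for k
    using that subgroup_Sym_D(1)[OF subgroup_X1] by (auto simp: induced_on_blocks_def)
  have component: "(\<lambda>d\<in>\<Delta>. inv_into \<Omega> (t (h ` g ` D)) (compose \<Omega> h g (t D d))) =
      (\<lambda>d\<in>\<Delta>. inv_into \<Omega> (t (g ` D)) (g (t D d))) \<otimes>\<^bsub>Sym \<Delta>\<^esub>
      (\<lambda>d\<in>\<Delta>. inv_into \<Omega> (t (h ` g ` D)) (h (t (g ` D) d)))" (is "?L = ?M \<otimes>\<^bsub>Sym \<Delta>\<^esub> ?N")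
    if D: "D \<in> \<Sigma>" for D
  proof -
    note gD = block_image[OF g D]
    have "?M \<in> Bij \<Delta>" "?N \<in> Bij \<Delta>"
      using subgroup_Sym_D(1)[OF subgroup_X0] component_in_X0[OF g D] component_in_X0[OF h gD]
      by auto
    moreover have "?L d = compose \<Delta> ?N ?M d" for d
    proof (cases "d \<in> \<Delta>")
      case True
      then have "g (t D d) \<in> g ` D" "t D d \<in> \<Omega>"
        using t_in_block[OF D True] block_subset[OF D] by auto
      then show ?thesis using True t_inv[OF gD] by (simp add: compose_def)
    qed (simp add: compose_def)
    ultimately show ?thesis by auto
  qed
  have "(\<lambda>D\<in>\<Sigma>. compose \<Omega> h g ` D) = (\<lambda>D\<in>\<Sigma>. g ` D) \<otimes>\<^bsub>Sym \<Sigma>\<^esub> (\<lambda>D\<in>\<Sigma>. h ` D)"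
    using blocks_Bij g h im block_image[OF g] by (auto simp: compose_def intro!: ext)
  then show "\<phi> (g \<otimes>\<^bsub>perm_group \<Omega> X\<^esub> h) = \<phi> g \<otimes>\<^bsub>wreath (perm_group \<Delta> X0) \<Sigma> X1\<^esub> \<phi> h"
    unfolding gh using im component block_image[OF g]
    by (auto simp: wreath_embed_def wreath_def intro!: restrict_ext)
qed

lemma coords_bij: "bij_betw \<psi> \<Omega> (\<Delta> \<times> \<Sigma>)"
proof (rule bij_betw_byWitness[where f' = "\<lambda>(d, D). t D d"])
  show "\<forall>x\<in>\<Omega>. (case \<psi> x of (d, D) \<Rightarrow> t D d) = x"
    by (auto elim!: block_ofE simp: transversal_coords_def t_inv)
  show "\<forall>p\<in>\<Delta> \<times> \<Sigma>. \<psi> (case p of (d, D) \<Rightarrow> t D d) = p"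
    using block_of_eq[OF _ t_in_block] inv_t by (auto simp: transversal_coords_def)
  show "\<psi> ` \<Omega> \<subseteq> \<Delta> \<times> \<Sigma>"
    by (auto elim!: block_ofE simp: transversal_coords_def t_inv)
  show "(\<lambda>(d, D). t D d) ` (\<Delta> \<times> \<Sigma>) \<subseteq> \<Omega>"
    using t_in_block block_subset by fastforce
qed

lemma embed_equivariant:
  assumes "x \<in> \<Omega>" "g \<in> X"
  shows "wreath_act (\<phi> g) (\<psi> x) = \<psi> (g x)"
proof -
  obtain D where D: "D \<in> \<Sigma>" "x \<in> D" "block_of \<Sigma> x = D" using assms(1) by (rule block_ofE)
  have "block_of \<Sigma> (g x) = g ` D"
    using block_of_eq[OF block_image[OF assms(2) D(1)]] D(2) by blast
  then show ?thesis
    using D t_inv[OF D(1,2)]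
    by (simp add: wreath_act_def wreath_embed_def transversal_coords_def)
qed

text \<open>
  Through the bijection \<open>\<psi>\<close> the pair \<open>\<phi>(g)\<close> determines the image under \<open>g\<close> of every point
  of \<open>\<Omega>\<close>.
\<close>

lemma embed_inj: "inj_on \<phi> X"
proof (rule inj_onI)
  fix g h assume g: "g \<in> X" and h: "h \<in> X" and eq: "\<phi> g = \<phi> h"
  have "g x = h x" if "x \<in> \<Omega>" for x
  proof -
    have "\<psi> (g x) = \<psi> (h x)"
      using embed_equivariant[OF that g] embed_equivariant[OF that h] eq by simp
    then show ?thesis
      using coords_bij that Bij_D(5)[OF X_Bij] g h by (auto simp: bij_betw_def inj_on_def)
  qed
  then show "g = h"
    using Bij_D(1)[OF X_Bij] g h by (intro extensionalityI[of g \<Omega> h]) auto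
qed

lemma perm_embedding_wreath_embed: "perm_embedding X \<Omega> X0 X1 \<Delta> \<Sigma> \<phi> \<psi>"
  using embed_hom embed_inj coords_bij embed_equivariant by (simp add: perm_embedding_def mon_def)

lemma embed_image_subgroup: "subgroup (\<phi> ` X) (wreath (perm_group \<Delta> X0) \<Sigma> X1)"
proof -
  have "group_hom (perm_group \<Omega> X) (wreath (perm_group \<Delta> X0) \<Sigma> X1) \<phi>"
    by (intro group_hom.intro group_hom_axioms.intro group_perm_group subgroup_X group_wreath_X
        embed_hom)
  from group_hom.img_is_subgroup[OF this] show ?thesis by simp
qed

text \<open>
  Both sides consist of elements \<open>\<phi>(g)\<close>. Fixing \<open>\<alpha>\<close> forces \<open>g\<close> to stabilise its block
  \<open>\<Delta>\<close>, and so does \<open>\<sigma> \<in> point_stabiliser X1 \<Delta>\<close>. As the transversal is the identity on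
  \<open>\<Delta>\<close>, the component \<open>f \<Delta>\<close> is then the restriction of \<open>g\<close>; it agrees on \<open>\<Delta>\<close> with an element
  fixing \<open>\<alpha>\<close> exactly if \<open>g\<close> fixes \<open>\<alpha>\<close>.
\<close>

lemma embed_point_stabiliser:
  assumes \<alpha>: "\<alpha> \<in> \<Delta>" and t_\<Delta>: "\<And>d. d \<in> \<Delta> \<Longrightarrow> t \<Delta> d = d"
  shows "\<phi> ` point_stabiliser X \<alpha> =
    {(f, \<sigma>) \<in> carrier (wreath (perm_group \<Delta> X0) \<Sigma> X1).
      f \<Delta> \<in> induced_on_set (point_stabiliser X \<alpha>) \<Delta> \<and> \<sigma> \<in> point_stabiliser X1 \<Delta>} \<inter> \<phi> ` X"
    (is "_ = ?A_hat \<inter> _")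
proof -
  have base: "fst (\<phi> g) \<Delta> = (\<lambda>d\<in>\<Delta>. g d)" if "g ` \<Delta> = \<Delta>" for g
  proof -
    have "inv_into \<Omega> (t \<Delta>) (g d) = g d" if "d \<in> \<Delta>" for d
      using inv_t[OF \<Delta>, of "g d"] t_\<Delta>[of "g d"] that \<open>g ` \<Delta> = \<Delta>\<close> by auto
    then show ?thesis
      using \<Delta> that t_\<Delta> by (auto simp: wreath_embed_def intro!: restrict_ext)
  qed
  have iff: "g \<in> point_stabiliser X \<alpha> \<longleftrightarrow> \<phi> g \<in> ?A_hat" if g: "g \<in> X" for g
  proof
    assume gA: "g \<in> point_stabiliser X \<alpha>"
    then have "\<alpha> \<in> g ` \<Delta>" using \<alpha> by (force simp: point_stabiliser_def)
    then have g\<Delta>: "g ` \<Delta> = \<Delta>"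
      using block_of_eq[OF block_image[OF g \<Delta>]] block_of_eq[OF \<Delta> \<alpha>] by simp
    have "\<phi> g \<in> carrier (wreath (perm_group \<Delta> X0) \<Sigma> X1)"
      using hom_in_carrier[OF embed_hom] g by simp
    moreover have "fst (\<phi> g) \<Delta> \<in> induced_on_set (point_stabiliser X \<alpha>) \<Delta>"
      using gA base[OF g\<Delta>] by (auto simp: induced_on_set_def)
    moreover have "snd (\<phi> g) \<in> point_stabiliser X1 \<Delta>"
      using g g\<Delta> \<Delta> by (auto simp: wreath_embed_def point_stabiliser_def induced_on_blocks_def)
    ultimately show "\<phi> g \<in> ?A_hat" by (auto simp: case_prod_beta)
  next
    assume "\<phi> g \<in> ?A_hat"
    then have f: "fst (\<phi> g) \<Delta> \<in> induced_on_set (point_stabiliser X \<alpha>) \<Delta>"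
      and s: "snd (\<phi> g) \<in> point_stabiliser X1 \<Delta>" by (auto simp: case_prod_beta)
    from s have "g ` \<Delta> = \<Delta>" using \<Delta> by (simp add: wreath_embed_def point_stabiliser_def)
    from base[OF this] f obtain a where a: "a \<in> point_stabiliser X \<alpha>"
      and ga: "(\<lambda>d\<in>\<Delta>. g d) = (\<lambda>d\<in>\<Delta>. a d)" by (auto simp: induced_on_set_def)
    have "g \<alpha> = \<alpha>" using a fun_cong[OF ga, of \<alpha>] \<alpha> by (simp add: point_stabiliser_def)
    then show "g \<in> point_stabiliser X \<alpha>" using g by (simp add: point_stabiliser_def)
  qed
  have "F ` P = Q \<inter> F ` X" if "\<And>g. g \<in> X \<Longrightarrow> g \<in> P \<longleftrightarrow> F g \<in> Q" "P \<subseteq> X"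
    for F :: "('a \<Rightarrow> 'a) \<Rightarrow> 'b" and P Q using that by auto
  from this[OF iff] show ?thesis by (simp add: point_stabiliser_def)
qed

end


section \<open>The embedding theorem\<close>

lemma ex_block_transversal:
  assumes X: "subgroup X (Sym \<Omega>)" and S: "block_system X \<Omega> \<Sigma>" and D: "\<Delta> \<in> \<Sigma>"
    and trans: "transitive_on (induced_on_blocks X \<Sigma>) \<Sigma>"
  obtains t where "block_transversal \<Omega> X \<Sigma> \<Delta> t" "\<And>d. d \<in> \<Delta> \<Longrightarrow> t \<Delta> d = d"
proof -
  have "\<exists>g\<in>X. g ` \<Delta> = E" if "E \<in> \<Sigma>" for E
    using trans D that by (fastforce simp: transitive_on_def induced_on_blocks_def)
  then obtain s where s: "\<And>E. E \<in> \<Sigma> \<Longrightarrow> s E \<in> X \<and> s E ` \<Delta> = E" by metis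
  \<comment> \<open>\<open>s \<Delta>\<close> only stabilises \<open>\<Delta>\<close>; the identity of \<open>X\<close> is the representative fixing it pointwise.\<close>
  define t where "t = s(\<Delta> := \<lambda>x\<in>\<Omega>. x)"
  have sub: "\<Delta> \<subseteq> \<Omega>" using S D by (auto simp: block_system_def partition_on_def)
  then have "(\<lambda>x\<in>\<Omega>. x) ` \<Delta> = \<Delta>" by force
  then have "block_transversal \<Omega> X \<Sigma> \<Delta> t"
    using X S D s subgroup_Sym_D(2)[OF X] by (auto simp: block_transversal_def t_def)
  moreover have "t \<Delta> d = d" if "d \<in> \<Delta>" for d using sub that by (auto simp: t_def)
  ultimately show ?thesis by (rule that)
qed

lemma transitive_on_blocks:
  assumes "transitive_on X \<Omega>" and S: "block_system X \<Omega> \<Sigma>"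
  shows "transitive_on (induced_on_blocks X \<Sigma>) \<Sigma>"
  unfolding transitive_on_def
proof (intro ballI)
  fix D E assume D: "D \<in> \<Sigma>" and E: "E \<in> \<Sigma>"
  have P: "partition_on \<Omega> \<Sigma>" using S by (simp add: block_system_def)
  obtain x y where xy: "x \<in> D" "y \<in> E" using P D E unfolding partition_on_def by fastforce
  then have "x \<in> \<Omega>" "y \<in> \<Omega>" using P D E by (auto simp: partition_on_def)
  then obtain g where g: "g \<in> X" "g x = y" using assms(1) by (auto simp: transitive_on_def)
  have gD: "g ` D \<in> \<Sigma>" using S g D by (simp add: block_system_def)
  have "y \<in> g ` D" using g xy by auto
  then have "g ` D = E"
    using P gD E xy(2) unfolding partition_on_def disjoint_def by blast
  then show "\<exists>\<sigma>\<in>induced_on_blocks X \<Sigma>. \<sigma> D = E"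
    using g(1) D by (auto simp: induced_on_blocks_def)
qed

theorem theorem2p1:
  fixes \<Omega> :: "'a set" and G B :: "('a \<Rightarrow> 'a) set" and \<Sigma> :: "'a set set"
    and \<Delta> :: "'a set" and \<alpha> :: 'a
    and G1 A1 B1 :: "('a set \<Rightarrow> 'a set) set" and G0 A A0 B0 :: "('a \<Rightarrow> 'a) set"
    and A_hat :: "(('a set \<Rightarrow> 'a \<Rightarrow> 'a) \<times> ('a set \<Rightarrow> 'a set)) set"
  assumes "finite \<Omega>"
    and "subgroup G (Sym \<Omega>)"
    and "transitive_on G \<Omega>"
    and "block_system G \<Omega> \<Sigma>"
    and "\<Delta> \<in> \<Sigma>"
    and "\<alpha> \<in> \<Delta>"
    and "G1 = induced_on_blocks G \<Sigma>"
    and "G0 = induced_on_set (setwise_stabiliser G \<Delta>) \<Delta>"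
    and "A = point_stabiliser G \<alpha>"
    and "A0 = induced_on_set A \<Delta>"
    and "A1 = point_stabiliser G1 \<Delta>"
    and "A_hat = {(f, \<sigma>) \<in> carrier (wreath (perm_group \<Delta> G0) \<Sigma> G1). f \<Delta> \<in> A0 \<and> \<sigma> \<in> A1}"
    and "subgroup B (perm_group \<Omega> G)"
    and "B1 = induced_on_blocks B \<Sigma>"
    and "B0 = induced_on_set (setwise_stabiliser B \<Delta>) \<Delta>"
  shows "(\<exists>\<phi> \<psi>. perm_embedding G \<Omega> G0 G1 \<Delta> \<Sigma> \<phi> \<psi> \<and> \<phi> ` A = A_hat \<inter> \<phi> ` G) \<and>
    (transitive_on B1 \<Sigma> \<longrightarrow>
      (\<exists>\<phi> \<psi>. perm_embedding G \<Omega> G0 G1 \<Delta> \<Sigma> \<phi> \<psi> \<and> \<phi> ` A = A_hat \<inter> \<phi> ` G \<and>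
        subgroup (\<phi> ` B) (wreath (perm_group \<Delta> B0) \<Sigma> B1)))"
proof -
  have sub_self: "subgroup G (perm_group \<Omega> G)"
    using group.subgroup_self[OF group_perm_group[OF assms(2)]] by simp
  \<comment> \<open>Both claims are instances: \<open>H = G\<close> gives the first and \<open>H = B\<close> the second.\<close>
  have embed: "\<exists>\<phi> \<psi>. perm_embedding G \<Omega> G0 G1 \<Delta> \<Sigma> \<phi> \<psi> \<and> \<phi> ` A = A_hat \<inter> \<phi> ` G \<and>
      subgroup (\<phi> ` H) (wreath (perm_group \<Delta> (induced_on_set (setwise_stabiliser H \<Delta>) \<Delta>)) \<Sigma>
        (induced_on_blocks H \<Sigma>))"
    if H: "subgroup H (perm_group \<Omega> G)" and trans: "transitive_on (induced_on_blocks H \<Sigma>) \<Sigma>"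
    for H
  proof -
    have HG: "H \<subseteq> G" using subgroup.subset[OF H] by simp
    have "subgroup H (Sym \<Omega>)"
      by (rule subgroup_Sym_if_subgroup_perm_group[OF assms(2) H])
    moreover have "block_system H \<Omega> \<Sigma>" using assms(4) HG by (auto simp: block_system_def)
    ultimately obtain t where t: "block_transversal \<Omega> H \<Sigma> \<Delta> t" "\<And>d. d \<in> \<Delta> \<Longrightarrow> t \<Delta> d = d"
      using ex_block_transversal[OF _ _ assms(5) trans] by blast
    interpret H: block_transversal \<Omega> H \<Sigma> \<Delta> t by fact
    interpret G: block_transversal \<Omega> G \<Sigma> \<Delta> t
      by (rule block_transversal.intro[OF assms(2,4,5)]) (use HG H.t_X H.t_image in auto)
    show ?thesis
      unfolding assms(7-12)
      by (intro exI conjI)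
        (rule G.perm_embedding_wreath_embed G.embed_point_stabiliser[OF assms(6) t(2)]
          H.embed_image_subgroup | assumption)+
  qed
  show ?thesis
  proof (intro conjI impI)
    show "\<exists>\<phi> \<psi>. perm_embedding G \<Omega> G0 G1 \<Delta> \<Sigma> \<phi> \<psi> \<and> \<phi> ` A = A_hat \<inter> \<phi> ` G"
      using embed[OF sub_self transitive_on_blocks[OF assms(3,4)]]
      by (elim exE conjE) (intro exI conjI)
    show "\<exists>\<phi> \<psi>. perm_embedding G \<Omega> G0 G1 \<Delta> \<Sigma> \<phi> \<psi> \<and> \<phi> ` A = A_hat \<inter> \<phi> ` G \<and>
        subgroup (\<phi> ` B) (wreath (perm_group \<Delta> B0) \<Sigma> B1)" if "transitive_on B1 \<Sigma>"
      using that unfolding assms(14,15) by (rule embed[OF assms(13)])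
  qed
qed

end
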